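(* Let $X$ be a real normed space, let $C\subset X$ be a closed (proper) cone and let $u\in X$ satisfy $\|u\|=1$ and $u\in\operatorname{int}C$. Then there exists a continuous positively homogeneous mapping $\varphi_{C,u}:X\to\mathbb R$ such that \[ C=\{x\in X:\varphi_{C,u}(x)\ge 0\},\qquad \operatorname{int}C=\{x\in X:\varphi_{C,u}(x)>0\},\qquad \operatorname{bd}C=\{x\in X:\varphi_{C,u}(x)=0\}, \] with $\varphi_{C,u}(u)=1$ and $|\varphi_{C,u}(x)|\le\|x\|$ for every $x\in X$.
   Context: A nonempty set $C\subset X$ is a cone if $tC\subset C$ for every $t\ge 0$. All cones are assumed proper, i.e. $\{0_X\}\subsetneq C\subsetneq X$ (no convexity is assumed). $\operatorname{int}$ and $\operatorname{bd}$ denote norm interior and norm boundary. A mapping $\varphi:X\to\mathbb R$ is positively homogeneous if $\varphi(tx)=t\varphi(x)$ for all $t\ge0$, $x\in X$. *)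

theory Defs
  imports "HOL-Analysis.Analysis"
begin

text \<open>
  The library predicate \<^const>\<open>cone\<close> admits the empty set; the strict inclusion
  \<open>{0} \<subset> C\<close> restores nonemptiness.
\<close>
definition proper_cone :: "'a::real_vector set \<Rightarrow> bool" where
  "proper_cone C \<longleftrightarrow> cone C \<and> {0} \<subset> C \<and> C \<subset> UNIV"

definition positively_homogeneous :: "('a::real_vector \<Rightarrow> real) \<Rightarrow> bool" where
  "positively_homogeneous \<phi> \<longleftrightarrow> (\<forall>t\<ge>0. \<forall>x. \<phi> (t *\<^sub>R x) = t * \<phi> x)"

end

theory Submission
  imports Defs
begin

text \<open>
  The signed distance \<open>g x = d(x, X - C) - d(x, C)\<close> is continuous, positively homogeneous and has
  the required sign pattern, but \<open>g u\<close> may be smaller than 1. Rescaling to \<open>g x / g u\<close> may violate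
  the bound by the norm, so the result is truncated to \<open>[-\<parallel>x\<parallel>, \<parallel>x\<parallel>]\<close>; this keeps signs, continuity
  and homogeneity, and the value at \<open>u\<close> is still 1.
\<close>

text \<open>Scaling by \<open>t\<close> sends \<open>S\<close> into itself and multiplies distances
  by \<open>t\<close>, so each \<open>y\<close> in \<open>S\<close> yields the competitor
  \<open>t *\<^sub>R y\<close>. Only \<open>t > 0\<close> is asked of \<open>S\<close>, so that the
  complement of a cone, which misses 0, qualifies too. For empty \<open>S\<close>,
  \<open>infdist\<close> is 0 by convention.\<close>

lemma infdist_scaleR_le:
  fixes S :: "'a::real_normed_vector set"
  assumes S: "\<And>t x. t > 0 \<Longrightarrow> x \<in> S \<Longrightarrow> t *\<^sub>R x \<in> S" and "t > 0"
  shows "infdist (t *\<^sub>R x) S \<le> t * infdist x S"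
proof (cases "S = {}")
  case False
  have "infdist (t *\<^sub>R x) S / t \<le> dist x y" if "y \<in> S" for y
  proof -
    have "infdist (t *\<^sub>R x) S \<le> dist (t *\<^sub>R x) (t *\<^sub>R y)"
      using S that \<open>t > 0\<close> by (intro infdist_le) auto
    also have "\<dots> = t * dist x y"
      using \<open>t > 0\<close> by (simp add: dist_norm flip: scaleR_diff_right)
    finally show ?thesis
      using \<open>t > 0\<close> by (simp add: field_simps)
  qed
  then have "infdist (t *\<^sub>R x) S / t \<le> infdist x S"
    using False by (simp add: infdist_notempty cINF_greatest)
  then show ?thesis
    using \<open>t > 0\<close> by (simp add: field_simps)
qed (simp add: infdist_def)

lemma infdist_scaleR:
  fixes S :: "'a::real_normed_vector set"
  assumes S: "\<And>t x. t > 0 \<Longrightarrow> x \<in> S \<Longrightarrow> t *\<^sub>R x \<in> S" and "t > 0"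
  shows "infdist (t *\<^sub>R x) S = t * infdist x S"
proof (rule antisym)
  show "infdist (t *\<^sub>R x) S \<le> t * infdist x S"
    using assms by (rule infdist_scaleR_le)
  \<comment> \<open>The reverse inequality is the previous lemma for the factor \<open>1/t\<close>
    at the point \<open>t *\<^sub>R x\<close>.\<close>
  have "infdist ((1/t) *\<^sub>R (t *\<^sub>R x)) S \<le> (1/t) * infdist (t *\<^sub>R x) S"
    using assms by (intro infdist_scaleR_le) auto
  then show "t * infdist x S \<le> infdist (t *\<^sub>R x) S"
    using \<open>t > 0\<close> by (simp add: field_simps)
qed

text \<open>Scaling the origin by 2 gives d = 2 d for d = \<open>infdist 0 S\<close>.\<close>

lemma infdist_zero_scale_invariant:
  fixes S :: "'a::real_normed_vector set"
  assumes S: "\<And>t x. t > 0 \<Longrightarrow> x \<in> S \<Longrightarrow> t *\<^sub>R x \<in> S"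
  shows "infdist 0 S = 0"
  using infdist_scaleR[OF S, of 2 0] by simp

lemma infdist_le_norm_scale_invariant:
  fixes S :: "'a::real_normed_vector set"
  assumes S: "\<And>t x. t > 0 \<Longrightarrow> x \<in> S \<Longrightarrow> t *\<^sub>R x \<in> S"
  shows "infdist x S \<le> norm x"
  using infdist_triangle[of x S 0] infdist_zero_scale_invariant[OF S] by simp

theorem lemma2p3:
  fixes C :: "'a::real_normed_vector set" and u :: 'a
  assumes "proper_cone C" and "closed C"
    and "norm u = 1" and "u \<in> interior C"
  shows "\<exists>\<phi> :: 'a \<Rightarrow> real.
           continuous_on UNIV \<phi> \<and> positively_homogeneous \<phi> \<and>
           C = {x. \<phi> x \<ge> 0} \<and>
           interior C = {x. \<phi> x > 0} \<and>
           frontier C = {x. \<phi> x = 0} \<and>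
           \<phi> u = 1 \<and> (\<forall>x. \<bar>\<phi> x\<bar> \<le> norm x)"
proof -
  have ne: "C \<noteq> {}" "- C \<noteq> {}"
    using assms(1) unfolding proper_cone_def by auto
  have scC: "t *\<^sub>R x \<in> C" if "t > 0" "x \<in> C" for t x
    using assms(1) that unfolding proper_cone_def cone_def by auto
  have scN: "t *\<^sub>R x \<in> - C" if "t > 0" "x \<in> - C" for t x
    using scC[of "1/t" "t *\<^sub>R x"] that by auto
  define g where "g x = infdist x (- C) - infdist x C" for x
  have g_le: "\<bar>g x\<bar> \<le> norm x" for x
    using infdist_le_norm_scale_invariant[OF scC, of x]
      infdist_le_norm_scale_invariant[OF scN, of x]
      infdist_nonneg[of x C] infdist_nonneg[of x "- C"]
    unfolding g_def by linarith
  have g_scale: "g (t *\<^sub>R x) = t * g x" if "t \<ge> 0" for t x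
  proof (cases "t = 0")
    \<comment> \<open>Scaling of \<open>infdist\<close> covers only \<open>t > 0\<close>; here the
      norm bound forces \<open>g 0 = 0\<close>.\<close>
    case True
    then show ?thesis using g_le[of 0] by simp
  next
    case False
    then show ?thesis
      using that infdist_scaleR[OF scC, of t x] infdist_scaleR[OF scN, of t x]
      by (simp add: g_def right_diff_distrib)
  qed
  have in_C: "x \<in> C \<longleftrightarrow> infdist x C = 0" for x
    using in_closed_iff_infdist_zero[OF assms(2) ne(1)] .
  \<comment> \<open>The interior is the complement of the closure of \<open>- C\<close>.\<close>
  have in_int: "x \<in> interior C \<longleftrightarrow> infdist x (- C) \<noteq> 0" for x
    using in_closure_iff_infdist_zero[OF ne(2), of x] by (auto simp: closure_complement)
  \<comment> \<open>Off \<open>C\<close> the first distance vanishes, and the second is positive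
    because \<open>C\<close> is closed.\<close>
  have g_neg: "g x < 0" if "x \<notin> C" for x
    using that in_C[of x] infdist_nonneg[of x C] by (simp add: g_def)
  have g_nonneg: "x \<in> C \<longleftrightarrow> g x \<ge> 0" for x
    using g_neg[of x] in_C[of x] infdist_nonneg[of x "- C"] by (force simp: g_def)
  have g_pos: "x \<in> interior C \<longleftrightarrow> g x > 0" for x
    using g_neg[of x] in_C[of x] in_int[of x] infdist_nonneg[of x "- C"] interior_subset[of C]
    by (cases "x \<in> C") (auto simp: g_def)
  have gu: "g u > 0"
    using assms(4) g_pos by simp
  define \<phi> where "\<phi> x = max (- norm x) (min (norm x) (g x / g u))" for x
  \<comment> \<open>Truncation could lose the sign only where \<open>norm x = 0\<close>, and there
    \<open>g_le\<close> gives \<open>g x = 0\<close>.\<close>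
  have phi_pos: "\<phi> x > 0 \<longleftrightarrow> g x > 0" for x
    using g_le[of x] gu by (auto simp: \<phi>_def less_max_iff_disj zero_less_divide_iff)
  have phi_nonneg: "\<phi> x \<ge> 0 \<longleftrightarrow> g x \<ge> 0" for x
    using g_le[of x] gu by (auto simp: \<phi>_def le_max_iff_disj zero_le_divide_iff)
  have "continuous_on UNIV \<phi>"
    unfolding \<phi>_def g_def using gu
    by (intro continuous_intros) (auto simp: g_def)
  moreover have "positively_homogeneous \<phi>"
    by (simp add: positively_homogeneous_def \<phi>_def g_scale max_mult_distrib_left min_mult_distrib_left)
  moreover have "C = {x. \<phi> x \<ge> 0}"
    using phi_nonneg g_nonneg by auto
  moreover have "interior C = {x. \<phi> x > 0}"
    using phi_pos g_pos by auto
  \<comment> \<open>As \<open>C\<close> is closed, its frontier is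
    \<open>C - interior C\<close>.\<close>
  moreover have "frontier C = {x. \<phi> x = 0}"
    using calculation(3,4) assms(2) by (auto simp: frontier_def)
  \<comment> \<open>The quotient at \<open>u\<close> is 1 = \<open>norm u\<close>, so truncation
    leaves it unchanged.\<close>
  moreover have "\<phi> u = 1"
    using gu assms(3) by (simp add: \<phi>_def)
  moreover have "\<bar>\<phi> x\<bar> \<le> norm x" for x
    by (simp add: \<phi>_def abs_le_iff minus_max_eq_min)
  ultimately show ?thesis
    by blast
qed

end
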